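(* Let $k\in\mathbb N$ and let $\mathcal C=\{1,3,2k\}$. Then the Sprague-Grundy sequence of the partition game with ruleset $\mathcal C$ is purely arithmetic-periodic with period $2k$, saltus $2$ and first $2k$ values $0,1,0,1,\ldots,0,1$ (the block $0,1$ repeated $k$ times); that is, for $1\le n\le 2k$ one has $\mathcal G(n)=0$ if $n$ is odd and $\mathcal G(n)=1$ if $n$ is even, and $\mathcal G(n+2k)=\mathcal G(n)+2$ for all $n\ge1$.
   Context: $\mathbb N=\{1,2,\ldots\}$ and $\mathbb N_0=\mathbb N\cup\{0\}$. A ruleset is a set $\mathcal C\subseteq\mathbb N$ of allowed cut-numbers. In the partition game with ruleset $\mathcal C$, positions are finite collections (disjunctive sums) of heaps of positive integer sizes; a move chooses one heap, of size $n$, chooses $c\in\mathcal C$, and replaces that heap by $c+1$ heaps of positive integer sizes $n_0,\ldots,n_c$ with $n_0+\cdots+n_c=n$ (a $c$-cut). The Sprague-Grundy value of a single heap of size $n\ge1$ is defined recursively by $$\mathcal G(n)=\operatorname{mex}\{\mathcal G(n_0)\oplus\cdots\oplus\mathcal G(n_c)\mid c\in\mathcal C,\ n_i\in\mathbb N,\ n_0+\cdots+n_c=n\},$$ where $\oplus$ is nim-sum (bitwise XOR) and $\operatorname{mex}(U)=\min(\mathbb N_0\setminus U)$. *)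

theory Defs
  imports Main
begin

definition mex :: "nat set \<Rightarrow> nat" where
  "mex U = (LEAST v. v \<notin> U)"

definition nim_sum :: "nat list \<Rightarrow> nat" where
  "nim_sum vs = foldr Bit_Operations.xor vs 0"

text \<open>
  The results of all cuts of a heap of size \<open>n\<close> under the ruleset \<open>C\<close>, as lists of heap sizes
  \<open>[n\<^sub>0, \<dots>, n\<^sub>c]\<close>. Cut-numbers are positive, so a \<open>0\<close> in \<open>C\<close> is ignored; this
  makes all resulting heaps smaller than \<open>n\<close>.
\<close>

definition cuts :: "nat set \<Rightarrow> nat \<Rightarrow> nat list set" where
  "cuts C n = {ns. \<exists>c\<in>C. 1 \<le> c \<and> length ns = c + 1 \<and> (\<forall>m\<in>set ns. 1 \<le> m) \<and> sum_list ns = n}"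

lemma cuts_less:
  assumes "ns \<in> cuts C n" and "m \<in> set ns"
  shows "m < n"
proof -
  obtain xs ys where ns: "ns = xs @ m # ys"
    using assms(2) by (meson split_list)
  have pos: "\<forall>x\<in>set (xs @ ys). 1 \<le> x" and "length (xs @ ys) \<ge> 1"
    and sum: "n = m + sum_list (xs @ ys)"
    using assms(1) by (auto simp: cuts_def ns)
  then obtain x zs where "xs @ ys = x # zs"
    by (cases "xs @ ys") auto
  with pos sum show ?thesis by simp
qed

text \<open>Heap sizes are positive; the value at \<open>0\<close> has no meaning.\<close>

function grundy :: "nat set \<Rightarrow> nat \<Rightarrow> nat" where
  "grundy C n = mex ((\<lambda>ns. nim_sum (map (grundy C) ns)) ` cuts C n)"
  by pat_completeness auto
termination
  by (relation "measure snd") (auto intro: cuts_less)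

declare grundy.simps [simp del]

text \<open>Sequences are indexed from \<open>1\<close>; the period need not be the least one.\<close>

definition purely_arithmetic_periodic :: "(nat \<Rightarrow> nat) \<Rightarrow> nat \<Rightarrow> nat \<Rightarrow> bool" where
  "purely_arithmetic_periodic f p s \<longleftrightarrow> 1 \<le> p \<and> (\<forall>n\<ge>1. f (n + p) = f n + s)"

end

theory Submission
  imports Defs
begin

text \<open>
  The claimed sequence has the closed form
  \<open>v(m) = 2 * ((m - 1) div (2 * k)) + (m - 1) mod 2\<close>, and strong induction on the heap size shows
  that it is the Sprague-Grundy sequence. Write \<open>q = (n - 1) div (2 * k)\<close>, so that \<open>v(n)\<close>
  consists of the upper bits \<open>q\<close> and the lowest bit \<open>(n - 1) mod 2\<close>.

  Every \<open>m \<ge> 1\<close> has \<open>v(m) \<equiv> m - 1\<close> modulo 2, so cutting \<open>n\<close> into \<open>l\<close> heaps always gives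
  a nim-sum congruent to \<open>n - l\<close>. The 1-cuts and 3-cuts produce an even number of heaps and hence
  only values of the parity opposite to \<open>v(n)\<close>; the \<open>2 * k\<close>-cuts produce only values of the same
  parity.

  No cut attains \<open>v(n)\<close>: by parity it would have to be a \<open>2 * k\<close>-cut. Such a cut uses up one
  unit for each of the \<open>2 * k + 1\<close> heaps, one full period more than the single unit that the heap
  of size \<open>n\<close> uses up. Hence the upper bits of its parts add up to at most \<open>q - 1\<close>, and a nim-sum
  is at most the ordinary sum (\<open>nim_sum_arith_value_less\<close>).

  All smaller values are attained, because two equal heaps cancel and can absorb any even surplus.
  A value of the parity of \<open>v(n)\<close> comes from one heap with that value, two equal heaps and
  otherwise heaps of size 1 (\<open>same_parity_value_attained\<close>). A value of the opposite parity comes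
  from the least heap with that value, one heap of size 1 and two equal heaps, which are left out
  if there is no surplus (\<open>opposite_parity_value_attained\<close>).
\<close>

section \<open>Minimal excludants and nim-sums\<close>

lemma mex_eqI:
  assumes "v \<notin> U" and "\<And>u. u < v \<Longrightarrow> u \<in> U"
  shows "mex U = v"
  unfolding mex_def using assms by (intro Least_equality) (auto simp: not_le[symmetric])

lemma nim_sum_Nil [simp]: "nim_sum [] = 0"
  and nim_sum_Cons [simp]: "nim_sum (v # vs) = Bit_Operations.xor v (nim_sum vs)"
  by (simp_all add: nim_sum_def)

lemma nim_sum_replicate_0 [simp]: "nim_sum (replicate n 0) = 0"
  by (induction n) simp_all

lemma xor_nat_cancel_left: "Bit_Operations.xor a (Bit_Operations.xor a b) = (b::nat)"
  by (simp flip: xor.assoc)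

lemma xor_nat_div_2: "Bit_Operations.xor a b div 2 = Bit_Operations.xor (a div 2) (b div 2 :: nat)"
  by (metis drop_bit_Suc drop_bit_0 drop_bit_xor id_apply)

lemma xor_nat_le_add: "Bit_Operations.xor a b \<le> (a + b :: nat)"
proof (induction a arbitrary: b rule: less_induct)
  case (less a)
  show ?case
  proof (cases "a = 0")
    case False
    then have "Bit_Operations.xor (a div 2) (b div 2) \<le> a div 2 + b div 2"
      by (intro less) auto
    moreover have "Bit_Operations.xor a b mod 2 \<le> a mod 2 + b mod 2"
      by (simp add: mod2_eq_if even_xor_iff)
    ultimately show ?thesis
      using xor_nat_div_2[of a b] div_mult_mod_eq[of a 2] div_mult_mod_eq[of b 2]
        div_mult_mod_eq[of "Bit_Operations.xor a b" 2] by linarith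
  qed simp
qed

lemma nim_sum_le_sum_list: "nim_sum vs \<le> sum_list vs"
proof (induction vs)
  case (Cons v vs)
  then show ?case using xor_nat_le_add[of v "nim_sum vs"] by simp
qed simp

lemma nim_sum_div_2: "nim_sum vs div 2 = nim_sum (map (\<lambda>v. v div 2) vs)"
  by (induction vs) (simp_all add: xor_nat_div_2)

section \<open>The closed form and the cuts\<close>

text \<open>
  The sequence with period \<open>2 * k\<close>, saltus 2 and first block \<open>0, 1, \<dots>, 0, 1\<close>. As the period is
  even, the lowest bit can be read off \<open>m - 1\<close> without reducing it modulo \<open>2 * k\<close> first.
\<close>

definition arith_value :: "nat \<Rightarrow> nat \<Rightarrow> nat" where
  "arith_value k m = 2 * ((m - 1) div (2 * k)) + (m - 1) mod 2"

lemma arith_value_div_2: "arith_value k m div 2 = (m - 1) div (2 * k)"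
  by (simp add: arith_value_def)

lemma arith_value_1 [simp]: "arith_value k (Suc 0) = 0"
  by (simp add: arith_value_def)

lemma arith_value_block:
  assumes "s < 2 * k"
  shows "arith_value k (Suc (2 * k * w + s)) = 2 * w + s mod 2"
proof -
  have "(2 * k * w + s) div (2 * k) = w"
    using assms by simp
  moreover have "(2 * k * w + s) mod 2 = s mod 2"
    by (simp add: mult.assoc)
  ultimately show ?thesis by (simp add: arith_value_def)
qed

lemma even_nim_sum_arith_value:
  assumes "\<forall>m\<in>set ns. 1 \<le> m"
  shows "even (nim_sum (map (arith_value k) ns)) \<longleftrightarrow> even (sum_list ns + length ns)"
  using assms
proof (induction ns)
  case (Cons m ns)
  have "even (arith_value k m) \<longleftrightarrow> odd m"
    using Cons.prems by (auto simp: arith_value_def)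
  with Cons show ?case by (simp add: even_xor_iff) blast
qed simp

lemma sum_list_div_le:
  fixes d :: nat
  assumes "\<forall>m\<in>set ns. 1 \<le> m"
  shows "d * sum_list (map (\<lambda>m. (m - 1) div d) ns) + length ns \<le> sum_list ns"
  using assms
proof (induction ns)
  case (Cons m ns)
  have "d * ((m - 1) div d) \<le> m - 1"
    by simp
  moreover have "1 \<le> m" and "d * sum_list (map (\<lambda>m. (m - 1) div d) ns) + length ns \<le> sum_list ns"
    using Cons by simp_all
  ultimately have "d * ((m - 1) div d) + d * sum_list (map (\<lambda>m. (m - 1) div d) ns)
    + (length ns + 1) \<le> m + sum_list ns" by linarith
  then show ?case by (simp add: distrib_left)
qed simp

text \<open>
  With more than \<open>2 * k\<close> parts, a full period is lost to the unit that each part uses up, so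
  already the ordinary sum of the upper bits falls below the upper bits of the whole heap.
\<close>

lemma nim_sum_arith_value_less:
  assumes "1 \<le> k" and "\<forall>m\<in>set ns. 1 \<le> m" and "2 * k < length ns"
  shows "nim_sum (map (arith_value k) ns) div 2 < arith_value k (sum_list ns) div 2"
proof -
  let ?upper = "map (\<lambda>m. (m - 1) div (2 * k)) ns"
  have "nim_sum (map (arith_value k) ns) div 2 = nim_sum ?upper"
    by (simp add: nim_sum_div_2 comp_def arith_value_div_2)
  also have "\<dots> \<le> sum_list ?upper"
    by (rule nim_sum_le_sum_list)
  also have "\<dots> < (sum_list ns - 1) div (2 * k)"
  proof -
    have "2 * k * sum_list ?upper + length ns \<le> sum_list ns"
      using assms by (intro sum_list_div_le)
    then have "Suc (sum_list ?upper) * (2 * k) \<le> sum_list ns - 1"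
      using assms by (simp add: algebra_simps)
    then have "Suc (sum_list ?upper) \<le> (sum_list ns - 1) div (2 * k)"
      using assms by (simp add: less_eq_div_iff_mult_less_eq)
    then show ?thesis by simp
  qed
  finally show ?thesis by (simp add: arith_value_div_2)
qed

lemma arith_value_not_attained:
  assumes "1 \<le> k" and "ns \<in> cuts {1, 3, 2 * k} n"
  shows "nim_sum (map (arith_value k) ns) \<noteq> arith_value k n"
proof
  assume eq: "nim_sum (map (arith_value k) ns) = arith_value k n"
  have pos: "\<forall>m\<in>set ns. 1 \<le> m" and sum: "sum_list ns = n"
    and len: "length ns = 2 \<or> length ns = 4 \<or> length ns = 2 * k + 1"
    using assms(2) by (auto simp: cuts_def)
  from len consider "even (length ns)" | "length ns = 2 * k + 1" by auto
  then show False
  proof cases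
    case 1
    have "1 \<le> n"
      using pos len sum by (cases ns) auto
    then have "even (arith_value k n) \<longleftrightarrow> odd n"
      by (auto simp: arith_value_def)
    with even_nim_sum_arith_value[OF pos, of k] 1 sum eq show False by auto
  next
    case 2
    with nim_sum_arith_value_less[OF assms(1) pos] sum eq show False by simp
  qed
qed

text \<open>
  The first heap takes the upper bits \<open>w\<close> and keeps the remainder of \<open>n - 1\<close> modulo \<open>2 * k\<close>. What is
  left, after one unit for each of the \<open>2 * k\<close> additional heaps, is a multiple of the even period,
  so it can be shared equally by two heaps, whose values cancel.
\<close>

lemma same_parity_value_attained:
  assumes "1 \<le> k" and "1 \<le> n" and "w < (n - 1) div (2 * k)"
  obtains ns where "ns \<in> cuts {1, 3, 2 * k} n"
    and "nim_sum (map (arith_value k) ns) = 2 * w + (n - 1) mod 2"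
proof -
  define s where "s = (n - 1) mod (2 * k)"
  have s: "s < 2 * k" and s2: "s mod 2 = (n - 1) mod 2"
    using assms(1) by (simp_all add: s_def mod_mod_cancel)
  obtain j where j: "(n - 1) div (2 * k) = w + 1 + j"
    using assms(3) by (metis less_iff_Suc_add Suc_eq_plus1 add.assoc add.commute)
  have n: "n = 2 * k * (w + 1 + j) + s + 1"
    using mult_div_mod_eq[of "2 * k" "n - 1"] assms(2) unfolding s_def j by linarith
  define ns where "ns = [Suc (2 * k * w + s), Suc (k * j), Suc (k * j)] @ replicate (2 * k - 2) 1"
  have "length ns = 2 * k + 1" and "\<forall>m\<in>set ns. 1 \<le> m"
    using assms(1) by (auto simp: ns_def)
  moreover have "sum_list ns = n"
    using assms(1) by (simp add: ns_def n sum_list_replicate algebra_simps)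
  ultimately have "ns \<in> cuts {1, 3, 2 * k} n"
    using assms(1) by (simp add: cuts_def)
  moreover have "nim_sum (map (arith_value k) ns) = 2 * w + (n - 1) mod 2"
    using s s2 by (simp add: ns_def arith_value_block xor_nat_cancel_left)
  ultimately show ?thesis by (rule that)
qed

text \<open>
  Let \<open>b + 1\<close> be the size of the least heap with the value sought. Together with a heap of size 1 it
  fits into \<open>n\<close> because the value is smaller than that of \<open>n\<close> and of the other parity. The rest
  \<open>n - (b + 2)\<close> is even, so it is either empty or two equal heaps, whose values cancel.
\<close>

lemma opposite_parity_value_attained:
  assumes "1 \<le> k" and "1 \<le> n" and "2 * w + n mod 2 < arith_value k n"
  obtains ns where "ns \<in> cuts {1, 3, 2 * k} n"
    and "nim_sum (map (arith_value k) ns) = 2 * w + n mod 2"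
proof -
  define b where "b = 2 * k * w + n mod 2"
  have val: "arith_value k (Suc b) = 2 * w + n mod 2"
    using assms(1) arith_value_block[of "n mod 2" k w] by (simp add: b_def)
  have "b + 2 \<le> n"
  proof (cases "even n")
    case True
    then have "w \<le> (n - 1) div (2 * k)"
      using assms(3) by (auto simp: arith_value_def mod2_eq_if split: if_splits)
    then have "2 * k * w \<le> n - 1"
      using assms(1) by (simp add: less_eq_div_iff_mult_less_eq mult.commute)
    moreover have "2 * k * w \<noteq> n - 1"
    proof
      assume "2 * k * w = n - 1"
      then have "even (n - 1)" by (metis dvd_triv_left mult.assoc)
      with True assms(2) show False by simp
    qed
    ultimately show ?thesis
      using True by (simp add: b_def)
  next
    case False
    then have "w + 1 \<le> (n - 1) div (2 * k)"
      using assms(3) by (simp add: arith_value_def mod2_eq_if)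
    then have "2 * k * (w + 1) \<le> n - 1"
      using assms(1) by (simp add: less_eq_div_iff_mult_less_eq mult.commute)
    moreover have "2 * k * w + 2 \<le> 2 * k * (w + 1)"
      using assms(1) by simp
    ultimately show ?thesis
      using False by (simp add: b_def mod2_eq_if)
  qed
  moreover have "even (n - (b + 2))"
    using \<open>b + 2 \<le> n\<close> by (simp add: b_def)
  ultimately obtain c where c: "n = b + 2 + 2 * c"
    by (metis dvdE le_add_diff_inverse)
  show ?thesis
  proof (cases "c = 0")
    case True
    have "[1, Suc b] \<in> cuts {1, 3, 2 * k} n"
      using True c by (simp add: cuts_def)
    then show ?thesis by (rule that) (simp add: val)
  next
    case False
    have "[1, Suc b, c, c] \<in> cuts {1, 3, 2 * k} n"
      using False c by (simp add: cuts_def)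
    then show ?thesis by (rule that) (simp add: val)
  qed
qed

lemma smaller_value_attained:
  assumes "1 \<le> k" and "1 \<le> n" and "u < arith_value k n"
  obtains ns where "ns \<in> cuts {1, 3, 2 * k} n" and "nim_sum (map (arith_value k) ns) = u"
proof -
  obtain w r where u: "u = 2 * w + r" and "r < 2"
    by (metis mult_div_mod_eq mod_less_divisor zero_less_numeral)
  then consider "r = n mod 2" | "r = (n - 1) mod 2"
    using assms(2) by (cases "even n") (auto simp: mod2_eq_if less_2_cases_iff)
  then show ?thesis
  proof cases
    case 1
    with assms(3) u have "2 * w + n mod 2 < arith_value k n" by simp
    then show ?thesis
      by (rule opposite_parity_value_attained[OF assms(1,2)]) (rule that, simp_all only: u 1)
  next
    case 2
    with assms(3) u have "w < (n - 1) div (2 * k)" by (simp add: arith_value_def)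
    then show ?thesis
      by (rule same_parity_value_attained[OF assms(1,2)]) (rule that, simp_all only: u 2)
  qed
qed

section \<open>The Sprague-Grundy sequence\<close>

lemma grundy_eq_arith_value:
  assumes "1 \<le> k" and "1 \<le> n"
  shows "grundy {1, 3, 2 * k} n = arith_value k n"
  using assms(2)
proof (induction n rule: less_induct)
  case (less n)
  let ?C = "{1, 3, 2 * k}"
  have parts: "map (grundy ?C) ns = map (arith_value k) ns" if "ns \<in> cuts ?C n" for ns
  proof (rule map_cong[OF refl])
    fix m assume "m \<in> set ns"
    moreover from this that have "1 \<le> m" by (auto simp: cuts_def)
    ultimately show "grundy ?C m = arith_value k m"
      using cuts_less[OF that] less.IH by blast
  qed
  have "grundy ?C n = mex ((\<lambda>ns. nim_sum (map (grundy ?C) ns)) ` cuts ?C n)"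
    by (rule grundy.simps)
  also have "\<dots> = mex ((\<lambda>ns. nim_sum (map (arith_value k) ns)) ` cuts ?C n)"
    by (intro arg_cong[of _ _ mex] image_cong refl) (simp only: parts)
  also have "\<dots> = arith_value k n"
  proof (rule mex_eqI)
    show "arith_value k n \<notin> (\<lambda>ns. nim_sum (map (arith_value k) ns)) ` cuts ?C n"
      by (rule notI, erule imageE) (drule arith_value_not_attained[OF assms(1)], erule notE, rule sym)
  next
    fix u assume "u < arith_value k n"
    then obtain ns where "ns \<in> cuts ?C n" and "nim_sum (map (arith_value k) ns) = u"
      by (rule smaller_value_attained[OF assms(1) less.prems])
    then show "u \<in> (\<lambda>ns. nim_sum (map (arith_value k) ns)) ` cuts ?C n"
      by blast
  qed
  finally show ?case .
qed

theorem proposition8: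
  fixes k :: nat
  assumes "1 \<le> k"
  shows "purely_arithmetic_periodic (grundy {1, 3, 2 * k}) (2 * k) 2
    \<and> (\<forall>n. 1 \<le> n \<and> n \<le> 2 * k \<longrightarrow> grundy {1, 3, 2 * k} n = (if odd n then 0 else 1))"
proof -
  have "arith_value k (n + 2 * k) = arith_value k n + 2" if "1 \<le> n" for n
  proof -
    obtain m where "n = Suc m"
      using \<open>1 \<le> n\<close> by (cases n) simp_all
    moreover have "(m + 2 * k) div (2 * k) = m div (2 * k) + 1"
      using assms by (intro div_add_self2) simp
    ultimately show ?thesis
      by (simp add: arith_value_def)
  qed
  moreover have "arith_value k n = (if odd n then 0 else 1)" if "1 \<le> n" "n \<le> 2 * k" for n
    using arith_value_block[of "n - 1" k 0] that by (auto simp: mod2_eq_if)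
  ultimately show ?thesis
    using assms by (simp add: purely_arithmetic_periodic_def grundy_eq_arith_value del: One_nat_def)
qed

end
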